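(* Let $\Omega\subseteq\mathbb{R}^{d+k}$ be a bounded set of the form $$\Omega=\left\{(\mathbf{x},\mathbf{y})\in\mathbb{R}^{d+k}\ \middle|\ h_l(\mathbf{x}_s,y^s)\le d_l\ (l\in\mathcal{H}_s,\ s\in\mathcal{K}),\ \mathbf{x}=\{\mathbf{x}_s\}_{s\in\mathcal{K}},\ \mathbf{A}\mathbf{y}\le\mathbf{b},\ \mathbf{y}\in\{0,1\}^k\right\},$$ where $\mathcal{K}=\{1,\dots,k\}$, each $\mathcal{H}_s$ is a finite index set, each $h_l$ is a closed convex function of $(\mathbf{x}_s,y^s)$, $d_l\in\mathbb{R}$, $\mathbf{A}$ is a totally unimodular matrix, $\mathbf{b}$ is an integer vector, and $\{\mathbf{y}\in\mathbb{R}^k\mid\mathbf{A}\mathbf{y}\le\mathbf{b}\}\subseteq[0,1]^k$. Let $\tilde\Omega^{\mathrm{per}}$ and (for $r\in\mathbb{Z}_+$) $\tilde\Omega^{\mathrm{agg}}$ be the sets defined in the context. Assume that $\tilde\Omega^{\mathrm{per}}$ contains a relative interior point (i.e. there is a point of $\tilde\Omega^{\mathrm{per}}$ lying in its relative interior). Then for every $r\in\mathbb{Z}_+$, $$\tilde\Omega^{\mathrm{agg}}=\mathrm{conv}(r\otimes\Omega)=r\odot\tilde\Omega^{\mathrm{per}}.$$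
   Context: $\mathbb{Z}_+$ is the set of nonnegative integers; $\mathrm{conv}$ denotes the convex hull. The vector $\mathbf{x}\in\mathbb{R}^d$ is partitioned into subvectors $\mathbf{x}_s$ ($s\in\mathcal{K}$), written $\mathbf{x}=\{\mathbf{x}_s\}_{s\in\mathcal{K}}$ (concatenation); $y^s$ is the $s$-th entry of $\mathbf{y}$. The same partition is used for $\mathbf{X}$. For a nonempty set $\mathcal{F}$ and a nonnegative integer $p$: $p\otimes\mathcal{F}=\{\sum_{i=1}^p\mathbf{x}_i\mid\mathbf{x}_1,\dots,\mathbf{x}_p\in\mathcal{F}\}$ if $p>0$ and $0\otimes\mathcal{F}=\{\mathbf{0}\}$. For real $r\ge0$: $r\odot\mathcal{F}=\{r\mathbf{x}\mid\mathbf{x}\in\mathcal{F}\}$ if $r>0$ and $0\odot\mathcal{F}=\{\mathbf{0}\}$. Closed convex functions are real-valued on a closed convex effective domain and $+\infty$ outside it. The perspective function of such a function $f$ with effective domain $\mathcal{F}$ is $F(\mathbf{x},t)=t f(\mathbf{x}/t)$ if $t>0$ and $\mathbf{x}/t\in\mathcal{F}$; $F(\mathbf{x},t)=0$ if $t=0$ and $\mathbf{x}=\mathbf{0}$; $F(\mathbf{x},t)=+\infty$ otherwise. For $l\in\mathcal{H}_s$ let $\hat h_l(\mathbf{x}_s)=h_l(\mathbf{x}_s,1)$ and $\bar h_l(\mathbf{x}_s)=h_l(\mathbf{x}_s,0)$, and let $\hat H_l,\bar H_l$ be their perspective functions. $\tilde\Omega^{\mathrm{per}}$ is the set of $(\mathbf{x},\mathbf{y})\in\mathbb{R}^{d+k}$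 with $\mathbf{x}=\{\mathbf{x}_s\}_{s\in\mathcal{K}}$ and $\mathbf{A}\mathbf{y}\le\mathbf{b}$ for which there exist vectors $\mathbf{w}_s,\mathbf{z}_s$ ($s\in\mathcal{K}$) with $\mathbf{x}_s=\mathbf{w}_s+\mathbf{z}_s$, $\hat H_l(\mathbf{w}_s,y^s)\le y^s d_l$ and $\bar H_l(\mathbf{z}_s,1-y^s)\le(1-y^s)d_l$ for all $l\in\mathcal{H}_s$, $s\in\mathcal{K}$. For $r\in\mathbb{Z}_+$, $\tilde\Omega^{\mathrm{agg}}$ is the set of $(\mathbf{X},\mathbf{Y})\in\mathbb{R}^{d+k}$ with $\mathbf{X}=\{\mathbf{X}_s\}_{s\in\mathcal{K}}$ and $\mathbf{A}\mathbf{Y}\le r\mathbf{b}$ for which there exist vectors $\mathbf{W}_s,\mathbf{Z}_s$ ($s\in\mathcal{K}$) with $\mathbf{X}_s=\mathbf{W}_s+\mathbf{Z}_s$, $\hat H_l(\mathbf{W}_s,Y^s)\le Y^s d_l$ and $\bar H_l(\mathbf{Z}_s,r-Y^s)\le(r-Y^s)d_l$ for all $l\in\mathcal{H}_s$, $s\in\mathcal{K}$. *)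

theory Defs
  imports "HOL-Analysis.Analysis" "Jordan_Normal_Form.Determinant"
begin

definition eff_dom :: "('a \<Rightarrow> ereal) \<Rightarrow> 'a set" where
  "eff_dom f = {x. f x < \<infinity>}"

definition closed_convex_fun :: "('a::euclidean_space \<Rightarrow> ereal) \<Rightarrow> bool" where
  "closed_convex_fun f \<longleftrightarrow>
     (\<forall>x. f x \<noteq> -\<infinity>) \<and> closed (eff_dom f) \<and>
     convex_on (eff_dom f) (\<lambda>x. real_of_ereal (f x)) \<and>
     closed (epigraph (eff_dom f) (\<lambda>x. real_of_ereal (f x)))"

definition perspective :: "('a::real_vector \<Rightarrow> ereal) \<Rightarrow> 'a \<Rightarrow> real \<Rightarrow> ereal" where
  "perspective f x t =
     (if t > 0 \<and> x /\<^sub>R t \<in> eff_dom f then ereal t * f (x /\<^sub>R t)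
      else if t = 0 \<and> x = 0 then 0 else \<infinity>)"

text \<open>
  For \<open>p = 0\<close> the only sum is the empty one, so \<open>sum_power 0 F = {0}\<close>.
\<close>

definition sum_power :: "nat \<Rightarrow> 'a::comm_monoid_add set \<Rightarrow> 'a set" where
  "sum_power p F = {(\<Sum>i<p. x i) | x. \<forall>i<p. x i \<in> F}"

definition dilate :: "real \<Rightarrow> 'a::real_vector set \<Rightarrow> 'a set" where
  "dilate r F = (if r = 0 then {0} else {r *\<^sub>R x | x. x \<in> F})"

text \<open>
  The square submatrices of \<open>A\<close> have varying size, so their determinants are taken with
  \<open>Determinant.det\<close>, whose dimension is not part of the type. The maps \<open>f\<close> and \<open>g\<close> list the
  selected rows and columns; listing them in a different order changes the determinant only
  by a sign.
\<close>

definition totally_unimodular :: "real^'n^'m \<Rightarrow> bool" where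
  "totally_unimodular A \<longleftrightarrow>
     (\<forall>n (f :: nat \<Rightarrow> 'm) (g :: nat \<Rightarrow> 'n).
        inj_on f {..<n} \<and> inj_on g {..<n} \<longrightarrow>
        Determinant.det (Matrix.mat n n (\<lambda>(i, j). vec_nth (vec_nth A (f i)) (g j))) \<in> {-1, 0, 1})"

text \<open>
  A partition of a vector \<open>x\<close> into subvectors is given by a map \<open>blk\<close> sending each coordinate
  to the block it belongs to. As the blocks may have different lengths, the space of the
  \<open>s\<close>-th subvectors is represented by the coordinate subspace \<open>block_space blk s\<close> of the full
  space, and the subvector \<open>x\<^sub>s\<close> by \<open>x\<close> with the coordinates outside block \<open>s\<close> set to zero.
  A closed convex function of \<open>x\<^sub>s\<close> and \<open>y\<^sup>s\<close> is accordingly one on the full space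
  whose effective domain lies in \<open>block_space blk s \<times> UNIV\<close>.
\<close>

definition block_space :: "('d::finite \<Rightarrow> 'k) \<Rightarrow> 'k \<Rightarrow> (real^'d) set" where
  "block_space blk s = {v. \<forall>i. blk i \<noteq> s \<longrightarrow> vec_nth v i = 0}"

definition subvec :: "('d::finite \<Rightarrow> 'k) \<Rightarrow> 'k \<Rightarrow> real^'d \<Rightarrow> real^'d" where
  "subvec blk s x = (\<chi> i. if blk i = s then vec_nth x i else 0)"

definition Omega ::
  "('d::finite \<Rightarrow> 'k::finite) \<Rightarrow> ('k \<Rightarrow> 'l set) \<Rightarrow> ('k \<Rightarrow> 'l \<Rightarrow> (real^'d) \<times> real \<Rightarrow> ereal) \<Rightarrow>
   ('k \<Rightarrow> 'l \<Rightarrow> real) \<Rightarrow> real^'k^'m::finite \<Rightarrow> real^'m \<Rightarrow> ((real^'d) \<times> (real^'k)) set" where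
  "Omega blk H h d A b =
     {(x, y). (\<forall>s. \<forall>l\<in>H s. h s l (subvec blk s x, vec_nth y s) \<le> ereal (d s l)) \<and>
              A *v y \<le> b \<and> (\<forall>s. vec_nth y s \<in> {0, 1})}"

definition Omega_per ::
  "('d::finite \<Rightarrow> 'k::finite) \<Rightarrow> ('k \<Rightarrow> 'l set) \<Rightarrow> ('k \<Rightarrow> 'l \<Rightarrow> (real^'d) \<times> real \<Rightarrow> ereal) \<Rightarrow>
   ('k \<Rightarrow> 'l \<Rightarrow> real) \<Rightarrow> real^'k^'m::finite \<Rightarrow> real^'m \<Rightarrow> ((real^'d) \<times> (real^'k)) set" where
  "Omega_per blk H h d A b =
     {(x, y). A *v y \<le> b \<and>
        (\<exists>w z. \<forall>s. w s \<in> block_space blk s \<and> z s \<in> block_space blk s \<and>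
           subvec blk s x = w s + z s \<and>
           (\<forall>l\<in>H s.
              perspective (\<lambda>v. h s l (v, 1)) (w s) (vec_nth y s) \<le> ereal (vec_nth y s * d s l) \<and>
              perspective (\<lambda>v. h s l (v, 0)) (z s) (1 - vec_nth y s)
                \<le> ereal ((1 - vec_nth y s) * d s l)))}"

definition Omega_agg ::
  "('d::finite \<Rightarrow> 'k::finite) \<Rightarrow> ('k \<Rightarrow> 'l set) \<Rightarrow> ('k \<Rightarrow> 'l \<Rightarrow> (real^'d) \<times> real \<Rightarrow> ereal) \<Rightarrow>
   ('k \<Rightarrow> 'l \<Rightarrow> real) \<Rightarrow> real^'k^'m::finite \<Rightarrow> real^'m \<Rightarrow> nat \<Rightarrow> ((real^'d) \<times> (real^'k)) set" where
  "Omega_agg blk H h d A b r =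
     {(X, Y). A *v Y \<le> real r *\<^sub>R b \<and>
        (\<exists>W Z. \<forall>s. W s \<in> block_space blk s \<and> Z s \<in> block_space blk s \<and>
           subvec blk s X = W s + Z s \<and>
           (\<forall>l\<in>H s.
              perspective (\<lambda>v. h s l (v, 1)) (W s) (vec_nth Y s) \<le> ereal (vec_nth Y s * d s l) \<and>
              perspective (\<lambda>v. h s l (v, 0)) (Z s) (real r - vec_nth Y s)
                \<le> ereal ((real r - vec_nth Y s) * d s l)))}"

end

theory Submission
  imports Defs
begin

text \<open>
  A bounded totally unimodular polyhedron with integral right-hand side is the convex hull of its
  integral points: the tight rows at an extreme point span the space, a basis chosen among them has
  determinant \<open>\<plusminus>1\<close>, and the adjugate expresses the point through integers. So for a point \<open>(x, y)\<close>
  of the perspective set, \<open>y\<close> is a convex combination of 0/1 points \<open>v\<close> of the polyhedron. Write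
  each block of \<open>x\<close> as \<open>y\<^sup>s a\<^sub>s + (1 - y\<^sup>s) c\<^sub>s\<close>, where \<open>a\<^sub>s\<close> and \<open>c\<^sub>s\<close> satisfy the constraints for
  \<open>y\<^sup>s = 1\<close> and \<open>y\<^sup>s = 0\<close>. Giving each \<open>v\<close> the block \<open>a\<^sub>s\<close> or \<open>c\<^sub>s\<close> according to \<open>v\<^sup>s\<close>, with the
  same weights, exhibits \<open>(x, y)\<close> as a convex combination of points of \<open>\<Omega>\<close>. The aggregated set is the
  dilation of the perspective set because perspectives are positively homogeneous; for \<open>r = 0\<close>,
  boundedness of \<open>\<Omega>\<close> is what kills the blocks without constraints.
\<close>

section \<open>Integrality of totally unimodular polytopes\<close>

lemma det_in_Ints:
  fixes M :: "'a::comm_ring_1 mat"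
  assumes "M \<in> carrier_mat n n" and "\<And>i j. i < n \<Longrightarrow> j < n \<Longrightarrow> M $$ (i, j) \<in> \<int>"
  shows "Determinant.det M \<in> \<int>"
proof -
  have "signof p * (\<Prod>i = 0..<n. M $$ (i, p i)) \<in> \<int>" if "p permutes {0..<n}" for p
  proof (rule Ints_mult)
    show "(signof p :: 'a) \<in> \<int>"
      by (simp add: sign_def)
    show "(\<Prod>i = 0..<n. M $$ (i, p i)) \<in> \<int>"
      by (rule Ints_prod) (use assms that permutes_in_image[OF that] in auto)
  qed
  then show ?thesis
    using assms(1) by (auto simp: Determinant.det_def intro!: Ints_sum)
qed

text \<open>Cramer's rule: the adjugate applied to \<open>M *\<^sub>v v\<close> is the determinant
  times \<open>v\<close>, and its entries are signed minors of an integer matrix. A determinant of 1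
  or -1 then divides out harmlessly.\<close>

lemma unimodular_solution_in_Ints:
  fixes M :: "'a::comm_ring_1 mat"
  assumes M: "M \<in> carrier_mat n n" and v: "v \<in> carrier_vec n"
    and ent: "\<And>i j. i < n \<Longrightarrow> j < n \<Longrightarrow> M $$ (i, j) \<in> \<int>"
    and det: "Determinant.det M \<in> {-1, 1}"
    and rhs: "\<And>i. i < n \<Longrightarrow> vec_index (M *\<^sub>v v) i \<in> \<int>"
    and i: "i < n"
  shows "vec_index v i \<in> \<int>"
proof -
  have adj: "adj_mat M \<in> carrier_mat n n" "adj_mat M * M = Determinant.det M \<cdot>\<^sub>m 1\<^sub>m n"
    using adj_mat[OF M] by auto
  have adj_ent: "adj_mat M $$ (i, j) \<in> \<int>" if "j < n" for j
  proof -
    have "Determinant.det (mat_delete M j i) \<in> \<int>"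
    proof (rule det_in_Ints)
      show "mat_delete M j i \<in> carrier_mat (n - 1) (n - 1)"
        using M by (simp add: mat_delete_def)
    next
      fix p q assume "p < n - 1" "q < n - 1"
      then show "mat_delete M j i $$ (p, q) \<in> \<int>"
        using M by (auto simp: mat_delete_def intro!: ent)
    qed
    then show ?thesis
      using M that i by (auto simp: adj_mat_def cofactor_def intro!: Ints_mult Ints_power)
  qed
  have "Determinant.det M \<cdot>\<^sub>v v = (adj_mat M * M) *\<^sub>v v"
    unfolding adj(2) using v by (intro eq_vecI) (auto simp: scalar_prod_def if_distrib if_distribR cong: if_cong)
  also have "\<dots> = adj_mat M *\<^sub>v (M *\<^sub>v v)"
    using adj M v by (metis assoc_mult_mat_vec)
  finally have "Determinant.det M * vec_index v i = vec_index (adj_mat M *\<^sub>v (M *\<^sub>v v)) i"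
    using i v by (metis carrier_vecD index_smult_vec(1))
  also have "\<dots> = (\<Sum>j = 0..<n. adj_mat M $$ (i, j) * vec_index (M *\<^sub>v v) j)"
    using i adj M v by (simp add: scalar_prod_def)
  also have "\<dots> \<in> \<int>"
    using adj_ent rhs by (auto intro!: Ints_sum Ints_mult)
  finally have "Determinant.det M * vec_index v i \<in> \<int>" .
  then show ?thesis
    using det minus_in_Ints_iff by auto
qed

lemma totally_unimodular_entry:
  fixes A :: "real^'n^'m"
  assumes "totally_unimodular A"
  shows "vec_nth (vec_nth A i) j \<in> {-1, 0, 1}"
proof -
  have "Determinant.det (Matrix.mat 1 1 (\<lambda>(p, q). vec_nth (vec_nth A i) j)) \<in> {-1, 0, 1}"
    using assms[unfolded totally_unimodular_def, rule_format, of "\<lambda>_. i" 1 "\<lambda>_. j"]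
    by (simp add: inj_on_def)
  then show ?thesis
    by (simp add: det_single)
qed

lemma mem_polyhedron_iff:
  fixes A :: "real^'n^'m::finite"
  shows "A *v y \<le> b \<longleftrightarrow> (\<forall>i. inner (vec_nth A i) y \<le> vec_nth b i)"
  by (simp add: Finite_Cartesian_Product.less_eq_vec_def matrix_vector_mul_component)

text \<open>Otherwise some nonzero \<open>v\<close> is orthogonal to all tight rows. A small move
  along \<open>v\<close> or \<open>-v\<close> keeps tight rows tight and, by continuity, does not
  violate the slack ones, so \<open>y\<close> is the midpoint of a proper segment inside the
  polyhedron.\<close>

lemma extreme_point_tight_rows:
  fixes A :: "real^'n^'m::finite"
  assumes ext: "y extreme_point_of {y. A *v y \<le> b}"
  shows "span {vec_nth A i | i. inner (vec_nth A i) y = vec_nth b i} = UNIV" (is "span ?R = _")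
proof (rule ccontr)
  assume "span ?R \<noteq> UNIV"
  then obtain v where v: "v \<noteq> 0" "\<forall>x\<in>span ?R. inner v x = 0"
    using span_not_UNIV_orthogonal by blast
  have y: "inner (vec_nth A i) y \<le> vec_nth b i" for i
    using ext by (auto simp: extreme_point_of_def mem_polyhedron_iff)
  have "\<forall>\<^sub>F t::real in at 0. inner (vec_nth A i) (y + t *\<^sub>R v) \<le> vec_nth b i \<and>
          inner (vec_nth A i) (y - t *\<^sub>R v) \<le> vec_nth b i" for i
  proof (cases "inner (vec_nth A i) y = vec_nth b i")
    case True
    then have "vec_nth A i \<in> span ?R"
      by (intro span_base) blast
    then have "inner (vec_nth A i) v = 0"
      using v(2) by (simp only: inner_commute[of "vec_nth A i"])
    with True show ?thesis
      by (simp add: inner_right_distrib inner_diff_right)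
  next
    case False
    with y have less: "inner (vec_nth A i) y < vec_nth b i"
      by (simp add: order.not_eq_order_implies_strict)
    have "((\<lambda>t. inner (vec_nth A i) (y + t *\<^sub>R v)) \<longlongrightarrow> inner (vec_nth A i) (y + 0 *\<^sub>R v)) (at (0::real))"
      "((\<lambda>t. inner (vec_nth A i) (y - t *\<^sub>R v)) \<longlongrightarrow> inner (vec_nth A i) (y - 0 *\<^sub>R v)) (at (0::real))"
      by (intro tendsto_intros)+
    with less have "\<forall>\<^sub>F t::real in at 0. inner (vec_nth A i) (y + t *\<^sub>R v) < vec_nth b i"
      "\<forall>\<^sub>F t::real in at 0. inner (vec_nth A i) (y - t *\<^sub>R v) < vec_nth b i"
      by (auto intro: order_tendstoD(2))
    then show ?thesis
      by eventually_elim auto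
  qed
  \<comment> \<open>There are finitely many rows, so one \<open>t\<close> serves all of them; the
    filter \<open>at 0\<close> allows it to be chosen nonzero.\<close>
  then have "\<forall>\<^sub>F t::real in at 0. \<forall>i. inner (vec_nth A i) (y + t *\<^sub>R v) \<le> vec_nth b i \<and>
          inner (vec_nth A i) (y - t *\<^sub>R v) \<le> vec_nth b i"
    by (rule eventually_all_finite)
  then have "\<forall>\<^sub>F t::real in at 0. t \<noteq> 0 \<and> A *v (y + t *\<^sub>R v) \<le> b \<and> A *v (y - t *\<^sub>R v) \<le> b"
    using eventually_neq_at_within[of 0 0 UNIV]
    by eventually_elim (auto simp: mem_polyhedron_iff)
  then obtain t :: real where t: "t \<noteq> 0" "A *v (y + t *\<^sub>R v) \<le> b" "A *v (y - t *\<^sub>R v) \<le> b"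
    using eventually_happens'[OF trivial_limit_at] by blast
  have "y = midpoint (y + t *\<^sub>R v) (y - t *\<^sub>R v)"
    by (simp add: midpoint_def scaleR_2[symmetric])
  moreover have "y + t *\<^sub>R v \<noteq> y - t *\<^sub>R v"
  proof
    assume "y + t *\<^sub>R v = y - t *\<^sub>R v"
    then have "(2 * t) *\<^sub>R v = 0"
      by (simp add: algebra_simps scaleR_2[symmetric])
    with t(1) v(1) show False by simp
  qed
  ultimately have "y \<in> open_segment (y + t *\<^sub>R v) (y - t *\<^sub>R v)"
    by (metis midpoint_in_open_segment)
  then show False
    using ext t by (auto simp: extreme_point_of_def)
qed

lemma totally_unimodular_extreme_point_in_Ints:
  fixes A :: "real^'n^'m::finite"
  assumes tu: "totally_unimodular A" and b: "\<And>i. vec_nth b i \<in> \<int>"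
    and ext: "y extreme_point_of {y. A *v y \<le> b}"
  shows "vec_nth y s \<in> \<int>"
proof -
  define n where "n = CARD('n)"
  let ?R = "{vec_nth A i | i. inner (vec_nth A i) y = vec_nth b i}"
  obtain B where B: "B \<subseteq> ?R" "independent B" "?R \<subseteq> span B"
    using maximal_independent_subset by blast
  have spanB: "span B = UNIV"
    using extreme_point_tight_rows[OF ext] span_minimal[OF B(3) subspace_span] by auto
  have "dim (span B) = n"
    unfolding spanB n_def by simp
  then have "card B = n"
    using dim_span_eq_card_independent[OF B(2)] by simp
  moreover have "finite B"
    using B(2) by (rule independent_imp_finite)
  ultimately obtain e where e: "bij_betw e {..<n} B"
    using ex_bij_betw_nat_finite by (metis atLeast0LessThan)
  have "\<forall>p\<in>{..<n}. \<exists>i. vec_nth A i = e p \<and> inner (vec_nth A i) y = vec_nth b i"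
    using e B(1) by (force simp: bij_betw_def)
  then obtain f where f: "\<And>p. p < n \<Longrightarrow> vec_nth A (f p) = e p"
      "\<And>p. p < n \<Longrightarrow> inner (vec_nth A (f p)) y = vec_nth b (f p)"
    by (metis lessThan_iff)
  \<comment> \<open>Total unimodularity speaks of injective selections. The rows \<open>e p\<close>
    are pairwise distinct, hence so are their indices, even if \<open>A\<close> repeats a
    row.\<close>
  have injf: "inj_on f {..<n}"
    using e f(1) by (metis (no_types, lifting) bij_betw_def inj_on_def lessThan_iff)
  \<comment> \<open>\<open>g\<close> lists all columns, so \<open>M\<close> below is the square
    matrix of the basis rows, and \<open>mult\<close> reads products with it as inner products with
    rows of \<open>A\<close>.\<close>
  obtain g where g: "bij_betw g {..<n} (UNIV :: 'n set)"
    using ex_bij_betw_nat_finite[of "UNIV :: 'n set"] by (auto simp: n_def atLeast0LessThan)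
  define M where "M = Matrix.mat n n (\<lambda>(p, q). vec_nth (vec_nth A (f p)) (g q))"
  have M: "M \<in> carrier_mat n n" by (simp add: M_def)
  have mult: "vec_index (M *\<^sub>v Matrix.vec n (\<lambda>q. vec_nth x (g q))) p = inner (vec_nth A (f p)) x"
    if "p < n" for p x
  proof -
    have "vec_index (M *\<^sub>v Matrix.vec n (\<lambda>q. vec_nth x (g q))) p
      = (\<Sum>q\<in>{..<n}. vec_nth (vec_nth A (f p)) (g q) * vec_nth x (g q))"
      using that by (simp add: M_def scalar_prod_def atLeast0LessThan)
    also have "\<dots> = (\<Sum>j\<in>UNIV. vec_nth (vec_nth A (f p)) j * vec_nth x j)"
      by (rule sum.reindex_bij_betw[OF g])
    finally show ?thesis by (simp add: inner_vec_def)
  qed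
  \<comment> \<open>A kernel vector, carried back to \<open>x\<close> through \<open>g\<close>, is
    orthogonal to every row in \<open>B\<close>; as \<open>B\<close> spans the space,
    \<open>x\<close> is orthogonal to itself.\<close>
  have "Determinant.det M \<noteq> 0"
  proof
    assume "Determinant.det M = 0"
    then obtain v where v: "v \<in> carrier_vec n" "v \<noteq> 0\<^sub>v n" "M *\<^sub>v v = 0\<^sub>v n"
      using det_0_iff_vec_prod_zero[OF M] by auto
    define x :: "real^'n" where "x = (\<chi> j. vec_index v (inv_into {..<n} g j))"
    have vx: "v = Matrix.vec n (\<lambda>q. vec_nth x (g q))"
      using v(1) g by (auto simp: x_def bij_betw_def inv_into_f_f)
    have "inner (vec_nth A (f p)) x = 0" if "p < n" for p
      using mult[OF that, of x] v(3) that by (simp add: vx[symmetric])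
    then have "Linear_Algebra.orthogonal x u" if "u \<in> B" for u
      using that e f(1) by (auto simp: bij_betw_def Linear_Algebra.orthogonal_def inner_commute)
    then have "Linear_Algebra.orthogonal x x"
      using orthogonal_to_span[of x B x] spanB by auto
    then have "x = 0" by (simp add: orthogonal_self)
    then show False using v(2) vx by auto
  qed
  moreover have "Determinant.det M \<in> {-1, 0, 1}"
    using tu injf g unfolding totally_unimodular_def M_def bij_betw_def by blast
  ultimately have det: "Determinant.det M \<in> {-1, 1}" by simp
  obtain p where p: "p < n" "g p = s"
    using g by (metis UNIV_I bij_betw_def imageE lessThan_iff)
  have "vec_index (Matrix.vec n (\<lambda>q. vec_nth y (g q))) p \<in> \<int>"
  proof (rule unimodular_solution_in_Ints[OF M _ _ det])
    fix i j assume "i < n" "j < n"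
    then show "M $$ (i, j) \<in> \<int>"
      using totally_unimodular_entry[OF tu, of "f i" "g j"] by (auto simp: M_def)
  qed (use mult f(2) b p in auto)
  then show ?thesis using p by simp
qed

text \<open>By Minkowski's theorem a compact convex set is the hull of its extreme points, and these
  are integral here.\<close>

lemma totally_unimodular_polytope_integral:
  fixes A :: "real^'n^'m::finite"
  assumes "totally_unimodular A" "\<And>i. vec_nth b i \<in> \<int>" "bounded {y. A *v y \<le> b}"
  shows "{y. A *v y \<le> b} = convex hull {y. A *v y \<le> b \<and> (\<forall>s. vec_nth y s \<in> \<int>)}"
    (is "?P = convex hull ?Q")
proof
  have P: "?P = (\<Inter>i. {y. inner (vec_nth A i) y \<le> vec_nth b i})"
    by (auto simp: mem_polyhedron_iff)
  have conv: "convex ?P"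
    unfolding P by (intro convex_INT convex_halfspace_le)
  have "closed ?P"
    unfolding P by (intro closed_INT ballI closed_halfspace_le)
  then have "?P = convex hull {y. y extreme_point_of ?P}"
    using Krein_Milman_Minkowski conv assms(3) by (metis compact_eq_bounded_closed)
  also have "\<dots> \<subseteq> convex hull ?Q"
    using totally_unimodular_extreme_point_in_Ints[OF assms(1,2)]
    by (intro hull_mono) (auto simp: extreme_point_of_def)
  finally show "?P \<subseteq> convex hull ?Q" .
  show "convex hull ?Q \<subseteq> ?P"
    by (rule hull_minimal) (use conv in auto)
qed

section \<open>Sublevel sets of perspectives\<close>

text \<open>Turns every perspective constraint into a sublevel condition on \<open>f\<close>. A
  finite bound already puts the point into the effective domain; at \<open>t = 0\<close> the bound
  is 0 and only \<open>x = 0\<close> meets it; for \<open>t < 0\<close> the perspective is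
  infinite.\<close>

lemma perspective_le_iff:
  "perspective f x t \<le> ereal (t * c) \<longleftrightarrow>
     t > 0 \<and> f (x /\<^sub>R t) \<le> ereal c \<or> t = 0 \<and> x = 0"
proof (cases "t > 0")
  case True
  have "ereal t * f (x /\<^sub>R t) \<le> ereal (t * c) \<longleftrightarrow> f (x /\<^sub>R t) \<le> ereal c"
    using True ereal_mult_le_mult_iff[of "ereal t" "f (x /\<^sub>R t)" "ereal c"] by simp
  moreover have "f (x /\<^sub>R t) \<le> ereal c \<Longrightarrow> x /\<^sub>R t \<in> eff_dom f"
    by (auto simp: eff_dom_def intro: le_less_trans)
  ultimately show ?thesis
    using True by (auto simp: perspective_def)
qed (auto simp: perspective_def)

lemma perspective_zero_le_iff: "perspective f x 0 \<le> ereal 0 \<longleftrightarrow> x = 0"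
  using perspective_le_iff[of f x 0 0] by simp

lemma perspective_le_scaleR:
  assumes "perspective f x t \<le> ereal (t * c)" and "a > 0"
  shows "perspective f (a *\<^sub>R x) (a * t) \<le> ereal (a * t * c)"
proof -
  have "(a *\<^sub>R x) /\<^sub>R (a * t) = x /\<^sub>R t"
    using assms(2) by (simp add: mult.commute)
  moreover have "0 < a * t" if "0 < t" using that assms(2) by simp
  ultimately show ?thesis
    using assms(1) unfolding perspective_le_iff by (metis mult_zero_right scaleR_zero_right)
qed

text \<open>The point \<open>(x + y) /\<^sub>R (t + u)\<close> is the convex combination of
  \<open>x /\<^sub>R t\<close> and \<open>y /\<^sub>R u\<close> with weights proportional to
  \<open>t\<close> and \<open>u\<close>. If \<open>t\<close> or \<open>u\<close> is zero, so is the
  vector that goes with it.\<close>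

lemma perspective_le_add:
  assumes conv: "convex {x. f x \<le> ereal c}"
    and "perspective f x t \<le> ereal (t * c)" "perspective f y u \<le> ereal (u * c)"
  shows "perspective f (x + y) (t + u) \<le> ereal ((t + u) * c)"
proof (cases "t = 0 \<or> u = 0")
  case True
  then show ?thesis using assms(2,3) by (auto simp: perspective_le_iff)
next
  case False
  then have tu: "t > 0" "u > 0" and f: "f (x /\<^sub>R t) \<le> ereal c" "f (y /\<^sub>R u) \<le> ereal c"
    using assms(2,3) by (auto simp: perspective_le_iff)
  have "(t / (t + u)) *\<^sub>R (x /\<^sub>R t) + (u / (t + u)) *\<^sub>R (y /\<^sub>R u) \<in> {x. f x \<le> ereal c}"
    using tu f by (intro convexD[OF conv]) (auto simp: add_divide_distrib[symmetric])
  moreover have "(t / (t + u)) *\<^sub>R (x /\<^sub>R t) + (u / (t + u)) *\<^sub>R (y /\<^sub>R u) = (x + y) /\<^sub>R (t + u)"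
    using tu by (simp add: scaleR_add_right field_simps)
  ultimately show ?thesis
    using tu by (auto simp: perspective_le_iff)
qed

lemma closed_convex_fun_convex_sublevel:
  assumes "closed_convex_fun f"
  shows "convex {v. f v \<le> ereal c}"
proof (rule convexI)
  fix x y :: 'a and u v :: real
  assume xy: "x \<in> {v. f v \<le> ereal c}" "y \<in> {v. f v \<le> ereal c}" and uv: "0 \<le> u" "0 \<le> v" "u + v = 1"
  let ?g = "\<lambda>x. real_of_ereal (f x)"
  have conv: "convex_on (eff_dom f) ?g" and minf: "\<And>x. f x \<noteq> -\<infinity>"
    using assms by (auto simp: closed_convex_fun_def)
  have real: "f z = ereal (?g z)" if "z \<in> eff_dom f" for z
    using that minf[of z] by (cases "f z") (auto simp: eff_dom_def)
  have dom: "x \<in> eff_dom f" "y \<in> eff_dom f"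
    using xy by (auto simp: eff_dom_def intro: le_less_trans)
  have z: "u *\<^sub>R x + v *\<^sub>R y \<in> eff_dom f"
    using convex_on_imp_convex[OF conv] dom uv by (auto intro: convexD)
  have "?g (u *\<^sub>R x + v *\<^sub>R y) \<le> u * ?g x + v * ?g y"
    using conv dom uv unfolding convex_on_def by blast
  also have "\<dots> \<le> u * c + v * c"
    using xy real[OF dom(1)] real[OF dom(2)] uv
    by (intro add_mono mult_left_mono) (metis ereal_less_eq(3) mem_Collect_eq)+
  also have "\<dots> = c"
    using uv by (simp add: distrib_right[symmetric])
  finally show "u *\<^sub>R x + v *\<^sub>R y \<in> {v. f v \<le> ereal c}"
    using real[OF z] by (metis ereal_less_eq(3) mem_Collect_eq)
qed

lemma closed_convex_fun_convex_slice:
  assumes "closed_convex_fun f"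
  shows "convex {v. f (v, t) \<le> ereal c}"
proof (rule convexI)
  fix x y :: 'a and u v :: real
  assume "x \<in> {v. f (v, t) \<le> ereal c}" "y \<in> {v. f (v, t) \<le> ereal c}" and uv: "0 \<le> u" "0 \<le> v" "u + v = 1"
  then have "u *\<^sub>R (x, t) + v *\<^sub>R (y, t) \<in> {v. f v \<le> ereal c}"
    by (intro convexD[OF closed_convex_fun_convex_sublevel[OF assms]]) auto
  then show "u *\<^sub>R x + v *\<^sub>R y \<in> {v. f (v, t) \<le> ereal c}"
    using uv(3) by (simp add: scaleR_add_left[symmetric] distrib_right[symmetric])
qed

section \<open>The cone of each block\<close>

lemma subspace_block_space: "subspace (block_space blk s)"
  by (auto simp: block_space_def subspace_def)

lemma linear_subvec: "linear (subvec blk s)"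
  by (rule linearI) (auto simp: subvec_def Finite_Cartesian_Product.vec_eq_iff)

lemma subvec_in_block_space: "subvec blk s x \<in> block_space blk s"
  by (simp add: subvec_def block_space_def)

text \<open>The two multipliers \<open>p\<close> and \<open>q\<close> are kept independent so that
  the set is closed under positive scaling and, for convex constraints, under addition. Setting
  \<open>p + q = 1\<close> gives the block condition of the perspective set,
  \<open>p + q = r\<close> that of the aggregated set.\<close>

definition disj_cone ::
  "'a::real_vector set \<Rightarrow> 'l set \<Rightarrow> ('l \<Rightarrow> 'a \<times> real \<Rightarrow> ereal) \<Rightarrow> ('l \<Rightarrow> real) \<Rightarrow> ('a \<times> real \<times> real) set" where
  "disj_cone V L h d = {(x, p, q). \<exists>w z. w \<in> V \<and> z \<in> V \<and> x = w + z \<and>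
     (\<forall>l\<in>L. perspective (\<lambda>v. h l (v, 1)) w p \<le> ereal (p * d l) \<and>
            perspective (\<lambda>v. h l (v, 0)) z q \<le> ereal (q * d l))}"

lemma mem_disj_cone_iff:
  "(x, p, q) \<in> disj_cone V L h d \<longleftrightarrow> (\<exists>w z. w \<in> V \<and> z \<in> V \<and> x = w + z \<and>
     (\<forall>l\<in>L. perspective (\<lambda>v. h l (v, 1)) w p \<le> ereal (p * d l) \<and>
            perspective (\<lambda>v. h l (v, 0)) z q \<le> ereal (q * d l)))"
  unfolding disj_cone_def mem_Collect_eq case_prod_conv ..

text \<open>By \<open>choice_iff\<close>, choosing \<open>W\<close> and \<open>Z\<close> for all
  blocks at once amounts to choosing them block by block; only \<open>A\<close> couples the
  blocks.\<close>

lemma mem_Omega_agg_iff: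
  "(X, Y) \<in> Omega_agg blk H h d A b r \<longleftrightarrow> A *v Y \<le> real r *\<^sub>R b \<and>
     (\<forall>s. (subvec blk s X, vec_nth Y s, real r - vec_nth Y s) \<in> disj_cone (block_space blk s) (H s) (h s) (d s))"
  by (simp only: Omega_agg_def mem_disj_cone_iff choice_iff mem_Collect_eq case_prod_conv)

lemma mem_Omega_per_iff:
  "(x, y) \<in> Omega_per blk H h d A b \<longleftrightarrow> A *v y \<le> b \<and>
     (\<forall>s. (subvec blk s x, vec_nth y s, 1 - vec_nth y s) \<in> disj_cone (block_space blk s) (H s) (h s) (d s))"
  by (simp only: Omega_per_def mem_disj_cone_iff choice_iff mem_Collect_eq case_prod_conv)

lemma disj_cone_scaleR:
  assumes "subspace V" "u \<in> disj_cone V L h d" "a > 0"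
  shows "a *\<^sub>R u \<in> disj_cone V L h d"
proof -
  obtain x p q where u: "u = (x, p, q)" by (metis prod.exhaust)
  then obtain w z where "w \<in> V" "z \<in> V" "x = w + z" and
    "\<forall>l\<in>L. perspective (\<lambda>v. h l (v, 1)) w p \<le> ereal (p * d l) \<and>
            perspective (\<lambda>v. h l (v, 0)) z q \<le> ereal (q * d l)"
    using assms(2) by (auto simp: mem_disj_cone_iff)
  then have "a *\<^sub>R w \<in> V" "a *\<^sub>R z \<in> V" "a *\<^sub>R x = a *\<^sub>R w + a *\<^sub>R z" and
    "\<forall>l\<in>L. perspective (\<lambda>v. h l (v, 1)) (a *\<^sub>R w) (a * p) \<le> ereal (a * p * d l) \<and>
            perspective (\<lambda>v. h l (v, 0)) (a *\<^sub>R z) (a * q) \<le> ereal (a * q * d l)"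
    using assms by (auto simp: subspace_scale scaleR_add_right intro: perspective_le_scaleR)
  then show ?thesis
    unfolding u scaleR_Pair real_scaleR_def mem_disj_cone_iff by blast
qed

lemma disj_cone_add:
  assumes V: "subspace V" and h: "\<And>l. l \<in> L \<Longrightarrow> closed_convex_fun (h l)"
    and "u \<in> disj_cone V L h d" "u' \<in> disj_cone V L h d"
  shows "u + u' \<in> disj_cone V L h d"
proof -
  obtain x p q x' p' q' where u: "u = (x, p, q)" "u' = (x', p', q')" by (metis prod.exhaust)
  obtain w z where wz: "w \<in> V" "z \<in> V" "x = w + z" and
    1: "\<forall>l\<in>L. perspective (\<lambda>v. h l (v, 1)) w p \<le> ereal (p * d l) \<and>
            perspective (\<lambda>v. h l (v, 0)) z q \<le> ereal (q * d l)"
    using assms(3) by (auto simp: u mem_disj_cone_iff)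
  obtain w' z' where wz': "w' \<in> V" "z' \<in> V" "x' = w' + z'" and
    2: "\<forall>l\<in>L. perspective (\<lambda>v. h l (v, 1)) w' p' \<le> ereal (p' * d l) \<and>
            perspective (\<lambda>v. h l (v, 0)) z' q' \<le> ereal (q' * d l)"
    using assms(4) by (auto simp: u mem_disj_cone_iff)
  have "w + w' \<in> V" "z + z' \<in> V" "x + x' = (w + w') + (z + z')"
    using wz wz' V by (auto simp: subspace_add)
  moreover have "\<forall>l\<in>L. perspective (\<lambda>v. h l (v, 1)) (w + w') (p + p') \<le> ereal ((p + p') * d l) \<and>
            perspective (\<lambda>v. h l (v, 0)) (z + z') (q + q') \<le> ereal ((q + q') * d l)"
    using 1 2 h by (auto intro!: perspective_le_add closed_convex_fun_convex_slice)
  ultimately show ?thesis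
    unfolding u add_Pair mem_disj_cone_iff by blast
qed

text \<open>The natural witnesses are \<open>w /\<^sub>R y\<close> and
  \<open>z /\<^sub>R (1 - y)\<close>; each satisfies its constraints whenever its weight is
  positive.\<close>

lemma disj_cone_decomposition:
  assumes V: "subspace V" and u: "(x, y, 1 - y) \<in> disj_cone V L h d"
  obtains a c where "a \<in> V" "c \<in> V" "x = y *\<^sub>R a + (1 - y) *\<^sub>R c"
    "\<And>l. l \<in> L \<Longrightarrow> y > 0 \<Longrightarrow> h l (a, 1) \<le> ereal (d l)"
    "\<And>l. l \<in> L \<Longrightarrow> y < 1 \<Longrightarrow> h l (c, 0) \<le> ereal (d l)"
proof (cases "L = {}")
  case True
  \<comment> \<open>Without constraints nothing forces \<open>w = 0\<close> at \<open>y = 0\<close>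
    or keeps \<open>y\<close> in the unit interval, so \<open>x\<close> itself serves as both
    witnesses.\<close>
  have "x \<in> V"
    using u V by (auto simp: mem_disj_cone_iff subspace_add)
  with True show ?thesis
    by (intro that[of x x]) (auto simp: scaleR_add_left[symmetric])
next
  case False
  obtain w z where wz: "w \<in> V" "z \<in> V" "x = w + z" and
    1: "\<And>l. l \<in> L \<Longrightarrow> y > 0 \<and> h l (w /\<^sub>R y, 1) \<le> ereal (d l) \<or> y = 0 \<and> w = 0"
    "\<And>l. l \<in> L \<Longrightarrow> 1 - y > 0 \<and> h l (z /\<^sub>R (1 - y), 0) \<le> ereal (d l) \<or> 1 - y = 0 \<and> z = 0"
    using u unfolding mem_disj_cone_iff perspective_le_iff by blast
  show ?thesis
  proof (rule that[of "w /\<^sub>R y" "z /\<^sub>R (1 - y)"])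
    \<comment> \<open>Division by zero yields zero, so a witness of weight zero vanishes; any
      constraint \<open>l\<close> makes the original \<open>w\<close> or \<open>z\<close> vanish
      too, and rescaling recovers it.\<close>
    obtain l where "l \<in> L" using False by auto
    then have "y = 0 \<Longrightarrow> w = 0" "1 - y = 0 \<Longrightarrow> z = 0"
      using 1[of l] by auto
    then have "y *\<^sub>R (w /\<^sub>R y) = w" "(1 - y) *\<^sub>R (z /\<^sub>R (1 - y)) = z"
      by (metis scaleR_zero_left scaleR_zero_right right_inverse scaleR_scaleR scaleR_one)+
    then show "x = y *\<^sub>R (w /\<^sub>R y) + (1 - y) *\<^sub>R (z /\<^sub>R (1 - y))"
      using wz(3) by simp
  qed (use V wz 1 in \<open>force intro: subspace_scale\<close>)+
qed

section \<open>The perspective set as a convex hull\<close>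

text \<open>Each block condition is membership in a convex cone of a triple that is affine in the
  point; the third entry keeps its form because the weights sum to 1.\<close>

lemma convex_Omega_per:
  assumes h: "\<And>s l. l \<in> H s \<Longrightarrow> closed_convex_fun (h s l)"
  shows "convex (Omega_per blk H h d A b)"
proof -
  \<comment> \<open>\<open>disj_cone_scaleR\<close> wants strictly positive factors; a zero weight
    leaves just one of the two points.\<close>
  have pos: "a *\<^sub>R p + c *\<^sub>R q \<in> Omega_per blk H h d A b"
    if p: "p \<in> Omega_per blk H h d A b" and q: "q \<in> Omega_per blk H h d A b" and ac: "0 < a" "0 < c" "a + c = 1"
    for p q a c
  proof -
    obtain x y x' y' where eq: "p = (x, y)" "q = (x', y')" by (metis prod.exhaust)
    have "inner (vec_nth A i) (a *\<^sub>R y + c *\<^sub>R y') \<le> vec_nth b i" for i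
    proof -
      have "inner (vec_nth A i) (a *\<^sub>R y + c *\<^sub>R y') = a * inner (vec_nth A i) y + c * inner (vec_nth A i) y'"
        by (simp add: inner_right_distrib)
      also have "\<dots> \<le> a * vec_nth b i + c * vec_nth b i"
        using p q ac by (intro add_mono mult_left_mono) (auto simp: eq mem_Omega_per_iff mem_polyhedron_iff)
      also have "\<dots> = vec_nth b i"
        using ac by (simp add: distrib_right[symmetric])
      finally show ?thesis .
    qed
    moreover have "(subvec blk s (a *\<^sub>R x + c *\<^sub>R x'), vec_nth (a *\<^sub>R y + c *\<^sub>R y') s, 1 - vec_nth (a *\<^sub>R y + c *\<^sub>R y') s)
        \<in> disj_cone (block_space blk s) (H s) (h s) (d s)" for s
    proof -
      have "a *\<^sub>R (subvec blk s x, vec_nth y s, 1 - vec_nth y s) + c *\<^sub>R (subvec blk s x', vec_nth y' s, 1 - vec_nth y' s)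
        \<in> disj_cone (block_space blk s) (H s) (h s) (d s)"
        using p q ac h
        by (intro disj_cone_add disj_cone_scaleR subspace_block_space) (auto simp: eq mem_Omega_per_iff)
      moreover have "a * (1 - vec_nth y s) + c * (1 - vec_nth y' s) = 1 - (a * vec_nth y s + c * vec_nth y' s)"
        using ac by (simp add: algebra_simps)
      ultimately show ?thesis
        by (simp add: linear_add[OF linear_subvec] linear_scale[OF linear_subvec])
    qed
    ultimately show ?thesis
      by (simp add: eq mem_Omega_per_iff mem_polyhedron_iff)
  qed
  show ?thesis
  proof (rule convexI)
    fix p q and a c :: real
    assume "p \<in> Omega_per blk H h d A b" "q \<in> Omega_per blk H h d A b" "0 \<le> a" "0 \<le> c" "a + c = 1"
    then show "a *\<^sub>R p + c *\<^sub>R q \<in> Omega_per blk H h d A b"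
      using pos[of p q a c] by (cases "a = 0 \<or> c = 0") auto
  qed
qed

text \<open>At a binary \<open>y\<close> the whole subvector goes into \<open>w\<close> if the entry
  is 1 and into \<open>z\<close> if it is 0, with zero for the other part.\<close>

lemma Omega_subset_Omega_per: "Omega blk H h d A b \<subseteq> Omega_per blk H h d A b"
proof
  fix p assume p: "p \<in> Omega blk H h d A b"
  obtain x y where eq: "p = (x, y)" by (metis prod.exhaust)
  have "(subvec blk s x, vec_nth y s, 1 - vec_nth y s) \<in> disj_cone (block_space blk s) (H s) (h s) (d s)" for s
  proof -
    have h: "\<And>l. l \<in> H s \<Longrightarrow> h s l (subvec blk s x, vec_nth y s) \<le> ereal (d s l)"
      using p by (auto simp: eq Omega_def)
    consider "vec_nth y s = 0" | "vec_nth y s = 1"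
      using p by (auto simp: eq Omega_def)
    then show ?thesis
    proof cases
      case 1
      with h show ?thesis
        unfolding mem_disj_cone_iff perspective_le_iff
        by (intro exI[of _ 0] exI[of _ "subvec blk s x"]) (auto simp: subspace_0 subspace_block_space subvec_in_block_space)
    next
      case 2
      with h show ?thesis
        unfolding mem_disj_cone_iff perspective_le_iff
        by (intro exI[of _ "subvec blk s x"] exI[of _ 0]) (auto simp: subspace_0 subspace_block_space subvec_in_block_space)
    qed
  qed
  then show "p \<in> Omega_per blk H h d A b"
    using p by (auto simp: eq mem_Omega_per_iff Omega_def)
qed

lemma Omega_per_subset_hull:
  fixes A :: "real^'k^'m::finite"
  assumes tu: "totally_unimodular A" and b: "\<And>i. vec_nth b i \<in> \<int>"
    and unit: "{y. A *v y \<le> b} \<subseteq> {y. \<forall>s. vec_nth y s \<in> {0..1}}"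
  shows "Omega_per blk H h d A b \<subseteq> convex hull Omega blk H h d A b"
proof
  fix p assume "p \<in> Omega_per blk H h d A b"
  moreover obtain x y where p: "p = (x, y)" by (metis prod.exhaust)
  ultimately have y: "A *v y \<le> b" and
    cone: "\<And>s. (subvec blk s x, vec_nth y s, 1 - vec_nth y s) \<in> disj_cone (block_space blk s) (H s) (h s) (d s)"
    by (auto simp: mem_Omega_per_iff)
  have "\<exists>a c. a \<in> block_space blk s \<and> c \<in> block_space blk s \<and>
      subvec blk s x = vec_nth y s *\<^sub>R a + (1 - vec_nth y s) *\<^sub>R c \<and>
      (\<forall>l\<in>H s. (vec_nth y s > 0 \<longrightarrow> h s l (a, 1) \<le> ereal (d s l)) \<and>
        (vec_nth y s < 1 \<longrightarrow> h s l (c, 0) \<le> ereal (d s l)))" for s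
    by (rule disj_cone_decomposition[OF subspace_block_space cone]) blast
  then obtain a c where ac: "\<And>s. a s \<in> block_space blk s" "\<And>s. c s \<in> block_space blk s"
      "\<And>s. subvec blk s x = vec_nth y s *\<^sub>R a s + (1 - vec_nth y s) *\<^sub>R c s"
    and a: "\<And>s l. l \<in> H s \<Longrightarrow> vec_nth y s > 0 \<Longrightarrow> h s l (a s, 1) \<le> ereal (d s l)"
    and c: "\<And>s l. l \<in> H s \<Longrightarrow> vec_nth y s < 1 \<Longrightarrow> h s l (c s, 0) \<le> ereal (d s l)"
    by metis
  have "{y. \<forall>s. vec_nth y s \<in> {0..1}} = cbox (0 :: real^'k) 1"
    by (auto simp: mem_box_cart)
  then have "bounded {y. A *v y \<le> b}"
    using unit bounded_cbox bounded_subset by metis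
  then have "y \<in> convex hull {y. A *v y \<le> b \<and> (\<forall>s. vec_nth y s \<in> \<int>)}"
    using totally_unimodular_polytope_integral[OF tu b] y by blast
  then obtain T l where T: "finite T" "T \<subseteq> {y. A *v y \<le> b \<and> (\<forall>s. vec_nth y s \<in> \<int>)}"
      and l: "\<forall>v\<in>T. 0 \<le> l v" "sum l T = 1" and ysum: "(\<Sum>v\<in>T. l v *\<^sub>R v) = y"
    unfolding convex_hull_explicit by blast
  \<comment> \<open>Without points of weight zero, \<open>v\<^sup>s = 1\<close> forces \<open>y\<^sup>s > 0\<close> and \<open>v\<^sup>s = 0\<close> forces \<open>y\<^sup>s < 1\<close>.\<close>
  define S where "S = {v \<in> T. l v > 0}"
  have S: "finite S" "\<And>v. v \<in> S \<Longrightarrow> l v > 0" "\<And>v. v \<in> S \<Longrightarrow> A *v v \<le> b"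
    using T by (auto simp: S_def)
  have S01: "vec_nth v s \<in> {0, 1}" if "v \<in> S" for v s
  proof -
    have "vec_nth v s \<in> {0..1}" "vec_nth v s \<in> \<int>"
      using that T(2) unit by (auto simp: S_def)
    then show ?thesis
      by (auto elim!: Ints_cases)
  qed
  have sumS: "(\<Sum>v\<in>S. l v *\<^sub>R f v) = (\<Sum>v\<in>T. l v *\<^sub>R f v)" for f :: "_ \<Rightarrow> 'z::real_vector"
    using T(1) l(1) by (intro sum.mono_neutral_left) (force simp: S_def)+
  have l1: "sum l S = 1"
    using sumS[of "\<lambda>_. 1::real"] l(2) by simp
  have ysum': "(\<Sum>v\<in>S. l v *\<^sub>R v) = y"
    using sumS[of "\<lambda>v. v"] ysum by simp
  have ys: "vec_nth y s = (\<Sum>v\<in>S. l v * vec_nth v s)" for s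
    by (simp add: ysum'[symmetric] sum_component)
  have ys1: "1 - vec_nth y s = (\<Sum>v\<in>S. l v * (1 - vec_nth v s))" for s
    by (simp add: ys l1 sum_subtractf right_diff_distrib)
  have unit_S: "0 \<le> vec_nth v s" "0 \<le> 1 - vec_nth v s" if "v \<in> S" for v s
    using S01[OF that, of s] by auto
  \<comment> \<open>In the sums for \<open>y\<close> and for its complement all terms are
    nonnegative, and the term of this \<open>v\<close> equals its positive weight
    \<open>l v\<close>.\<close>
  have pos: "vec_nth y s > 0" if "v \<in> S" "vec_nth v s = 1" for v s
    unfolding ys using that S(2)
    by (intro sum_pos2[OF S(1) that(1)] mult_nonneg_nonneg unit_S less_imp_le) auto
  have less1: "vec_nth y s < 1" if "v \<in> S" "vec_nth v s = 0" for v s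
  proof -
    have "0 < 1 - vec_nth y s"
      unfolding ys1 using that S(2)
      by (intro sum_pos2[OF S(1) that(1)] mult_nonneg_nonneg unit_S less_imp_le) auto
    then show ?thesis by simp
  qed
  \<comment> \<open>At a 0/1 vector \<open>v\<close> this selects \<open>a\<close> or
    \<open>c\<close> in each block. Being affine in \<open>v\<close>, it averages over
    \<open>S\<close> to the same expression at \<open>y\<close>, which is \<open>x\<close>.\<close>
  define X :: "real^'k \<Rightarrow> real^_" where
    "X v = (\<chi> i. vec_nth v (blk i) * vec_nth (a (blk i)) i + (1 - vec_nth v (blk i)) * vec_nth (c (blk i)) i)" for v
  have subX: "subvec blk s (X v) = vec_nth v s *\<^sub>R a s + (1 - vec_nth v s) *\<^sub>R c s" for v s
    using ac(1,2)[of s] by (auto simp: Finite_Cartesian_Product.vec_eq_iff subvec_def X_def block_space_def)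
  have mem: "(X v, v) \<in> Omega blk H h d A b" if v: "v \<in> S" for v
    unfolding Omega_def mem_Collect_eq case_prod_conv
  proof (intro conjI allI ballI)
    fix s l' assume l': "l' \<in> H s"
    consider "vec_nth v s = 1" | "vec_nth v s = 0" using S01[OF v, of s] by auto
    then show "h s l' (subvec blk s (X v), vec_nth v s) \<le> ereal (d s l')"
    proof cases
      case 1
      then show ?thesis using a[OF l' pos[OF v 1]] by (simp add: subX)
    next
      case 2
      then show ?thesis using c[OF l' less1[OF v 2]] by (simp add: subX)
    qed
  qed (use S S01 v in auto)
  have in_hull: "(\<Sum>v\<in>S. l v *\<^sub>R (X v, v)) \<in> convex hull Omega blk H h d A b"
    using S l1 mem by (intro convex_sum) (auto intro: hull_inc less_imp_le)
  have "(\<Sum>v\<in>S. l v *\<^sub>R X v) = x"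
  proof -
    have "vec_nth (\<Sum>v\<in>S. l v *\<^sub>R X v) i = vec_nth x i" for i
    proof -
      let ?s = "blk i"
      have "vec_nth (\<Sum>v\<in>S. l v *\<^sub>R X v) i
        = (\<Sum>v\<in>S. l v * vec_nth v ?s * vec_nth (a ?s) i + l v * (1 - vec_nth v ?s) * vec_nth (c ?s) i)"
        by (simp add: sum_component X_def algebra_simps)
      also have "\<dots> = vec_nth y ?s * vec_nth (a ?s) i + (1 - vec_nth y ?s) * vec_nth (c ?s) i"
        unfolding ys1 unfolding ys by (simp add: sum.distrib sum_distrib_right)
      also have "\<dots> = vec_nth (subvec blk ?s x) i"
        by (simp add: ac(3))
      also have "\<dots> = vec_nth x i"
        by (simp add: subvec_def)
      finally show ?thesis .
    qed
    then show ?thesis by (simp add: Finite_Cartesian_Product.vec_eq_iff)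
  qed
  with ysum' have "(\<Sum>v\<in>S. l v *\<^sub>R (X v, v)) = (x, y)"
    by (simp add: prod_eq_iff fst_sum snd_sum)
  with in_hull show "p \<in> convex hull Omega blk H h d A b"
    by (simp only: p)
qed

section \<open>Dilation and aggregation\<close>

lemma dilate_pos: "r > 0 \<Longrightarrow> dilate r F = (*\<^sub>R) r ` F"
  by (auto simp: dilate_def)

text \<open>A sum of \<open>r\<close> points is \<open>r\<close> times their average, and
  \<open>r\<close> times a point is the sum of \<open>r\<close> copies of it. For
  \<open>r = 0\<close> both sides are the origin, even for empty \<open>F\<close>.\<close>

lemma convex_hull_sum_power:
  fixes F :: "'a::real_vector set"
  shows "convex hull (sum_power r F) = dilate (real r) (convex hull F)"
proof (cases "r = 0")
  case True
  then show ?thesis by (simp add: sum_power_def dilate_def)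
next
  case False
  have "sum_power r F \<subseteq> (*\<^sub>R) (real r) ` (convex hull F)"
  proof
    fix v assume "v \<in> sum_power r F"
    then obtain x where v: "v = (\<Sum>i<r. x i)" and x: "\<forall>i<r. x i \<in> F"
      by (auto simp: sum_power_def)
    have "(\<Sum>i<r. (1 / real r) *\<^sub>R x i) \<in> convex hull F"
      using x False by (intro convex_sum) (auto intro: hull_inc)
    moreover have "v = real r *\<^sub>R (\<Sum>i<r. (1 / real r) *\<^sub>R x i)"
      using False by (simp add: v scaleR_sum_right)
    ultimately show "v \<in> (*\<^sub>R) (real r) ` (convex hull F)" by blast
  qed
  then have 1: "convex hull (sum_power r F) \<subseteq> (*\<^sub>R) (real r) ` (convex hull F)"
    by (intro hull_minimal convex_scaling convex_convex_hull)
  have "(*\<^sub>R) (real r) ` F \<subseteq> sum_power r F"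
  proof
    fix v assume "v \<in> (*\<^sub>R) (real r) ` F"
    then obtain x where "x \<in> F" "v = (\<Sum>i<r. x)"
      by (auto simp: sum_constant_scaleR)
    then show "v \<in> sum_power r F"
      unfolding sum_power_def mem_Collect_eq by (intro exI[of _ "\<lambda>_. x"]) auto
  qed
  then have "(*\<^sub>R) (real r) ` (convex hull F) \<subseteq> convex hull (sum_power r F)"
    unfolding convex_hull_scaling[symmetric] by (rule hull_mono)
  with 1 False show ?thesis by (simp add: dilate_pos)
qed

text \<open>Both the linear system and the block cones are invariant under scaling by
  \<open>r\<close> and back by its inverse.\<close>

lemma Omega_agg_eq_dilate:
  assumes "r > 0"
  shows "Omega_agg blk H h d A b r = dilate (real r) (Omega_per blk H h d A b)"
proof -
  have r: "real r > 0" using assms by simp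
  have key: "(real r *\<^sub>R x, real r *\<^sub>R y) \<in> Omega_agg blk H h d A b r \<longleftrightarrow> (x, y) \<in> Omega_per blk H h d A b" for x y
  proof -
    have "A *v (real r *\<^sub>R y) \<le> real r *\<^sub>R b \<longleftrightarrow> A *v y \<le> b"
      using r by (simp add: mem_polyhedron_iff)
    moreover have "(subvec blk s (real r *\<^sub>R x), vec_nth (real r *\<^sub>R y) s, real r - vec_nth (real r *\<^sub>R y) s)
          \<in> disj_cone (block_space blk s) (H s) (h s) (d s) \<longleftrightarrow>
        (subvec blk s x, vec_nth y s, 1 - vec_nth y s) \<in> disj_cone (block_space blk s) (H s) (h s) (d s)" for s
    proof -
      let ?C = "disj_cone (block_space blk s) (H s) (h s) (d s)"
      let ?u = "(subvec blk s x, vec_nth y s, 1 - vec_nth y s)"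
      have "(subvec blk s (real r *\<^sub>R x), vec_nth (real r *\<^sub>R y) s, real r - vec_nth (real r *\<^sub>R y) s) = real r *\<^sub>R ?u"
        by (simp add: linear_scale[OF linear_subvec] right_diff_distrib)
      moreover have "?u = (1 / real r) *\<^sub>R (real r *\<^sub>R ?u)"
        using r by simp
      ultimately show ?thesis
        using disj_cone_scaleR[OF subspace_block_space, of _ blk s "H s" "h s" "d s"] r
        by (metis zero_less_divide_1_iff)
    qed
    ultimately show ?thesis
      by (simp only: mem_Omega_agg_iff mem_Omega_per_iff)
  qed
  show ?thesis
  proof (rule Set.set_eqI, rule iffI)
    fix p assume p: "p \<in> Omega_agg blk H h d A b r"
    obtain X Y where eq: "p = (X, Y)" by (metis prod.exhaust)
    have "(X /\<^sub>R real r, Y /\<^sub>R real r) \<in> Omega_per blk H h d A b"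
      using p r key[of "X /\<^sub>R real r" "Y /\<^sub>R real r"] by (simp add: eq)
    then show "p \<in> dilate (real r) (Omega_per blk H h d A b)"
      using r by (auto simp: dilate_pos eq intro!: image_eqI[of _ _ "(X /\<^sub>R real r, Y /\<^sub>R real r)"])
  qed (use r key in \<open>auto simp: dilate_pos\<close>)
qed

lemma zero_on_ray_bounded:
  fixes v :: "'a::real_normed_vector"
  assumes "bounded S" and "\<And>t. t \<ge> 0 \<Longrightarrow> y + t *\<^sub>R v \<in> S"
  shows "v = 0"
proof (rule ccontr)
  assume v: "v \<noteq> 0"
  obtain B where B: "\<And>x. x \<in> S \<Longrightarrow> norm x \<le> B"
    using assms(1) by (auto simp: bounded_iff)
  \<comment> \<open>Chosen so that \<open>t *\<^sub>R v\<close> has norm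
    \<open>B + norm y + 1\<close>, one more than the triangle inequality permits.\<close>
  define t where "t = (B + norm y + 1) / norm v"
  have "norm y \<le> B" using B[OF assms(2)[of 0]] by simp
  then have "0 \<le> B + norm y + 1"
    using norm_ge_zero[of y] by linarith
  then have t: "t \<ge> 0" and "\<bar>B + norm y + 1\<bar> = B + norm y + 1" by (auto simp: t_def)
  then have "norm (t *\<^sub>R v) = B + norm y + 1"
    using v by (simp add: t_def)
  moreover have "norm (t *\<^sub>R v) \<le> norm (y + t *\<^sub>R v) + norm y"
    by (metis add_diff_cancel_left' norm_triangle_ineq4)
  ultimately show False using B[OF assms(2)[OF t]] by simp
qed

text \<open>\<open>Y\<close> is a recession direction of a polyhedron inside the unit cube, hence
  zero. Perspectives at 0 then annihilate each constrained block. A point of \<open>Omega\<close>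
  supplies the origin of the rays.\<close>

lemma Omega_agg_0:
  fixes A :: "real^'k^'m::finite"
  assumes unit: "{y. A *v y \<le> b} \<subseteq> {y. \<forall>s. vec_nth y s \<in> {0..1}}"
    and bdd: "bounded (Omega blk H h d A b)" and ne: "Omega blk H h d A b \<noteq> {}"
  shows "Omega_agg blk H h d A b 0 = {0}"
proof -
  obtain x0 y0 where xy0: "(x0, y0) \<in> Omega blk H h d A b" using ne by auto
  have "p = 0" if p: "p \<in> Omega_agg blk H h d A b 0" for p
  proof -
    obtain X Y where eq: "p = (X, Y)" by (metis prod.exhaust)
    have AY: "A *v Y \<le> 0"
      using p by (simp add: eq mem_Omega_agg_iff)
    have cone: "(subvec blk s X, vec_nth Y s, - vec_nth Y s) \<in> disj_cone (block_space blk s) (H s) (h s) (d s)" for s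
      using p by (simp add: eq mem_Omega_agg_iff)
    have "y0 + t *\<^sub>R Y \<in> cbox 0 1" if "t \<ge> 0" for t
    proof -
      have "inner (vec_nth A i) (y0 + t *\<^sub>R Y) \<le> vec_nth b i" for i
        using xy0 AY that mult_nonneg_nonpos[of t "inner (vec_nth A i) Y"]
        by (auto simp: Omega_def mem_polyhedron_iff inner_right_distrib intro!: add_mono[of _ "vec_nth b i" _ 0, simplified])
      then have "y0 + t *\<^sub>R Y \<in> {y. A *v y \<le> b}" by (simp add: mem_polyhedron_iff)
      with unit have "\<forall>s. vec_nth (y0 + t *\<^sub>R Y) s \<in> {0..1}" by blast
      then show ?thesis by (simp add: mem_box_cart)
    qed
    then have Y: "Y = 0"
      by (rule zero_on_ray_bounded[OF bounded_cbox])
    have X: "subvec blk s X = 0" for s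
    proof (cases "H s = {}")
      case True
      \<comment> \<open>No constraint sees a block with empty \<open>H s\<close>, so
        \<open>x0\<close> may be shifted arbitrarily far within it, against boundedness unless the
        shift is zero.\<close>
      have "(x0, y0) + t *\<^sub>R (subvec blk s X, 0) \<in> Omega blk H h d A b" for t
      proof -
        have "h s' l (subvec blk s' (x0 + t *\<^sub>R subvec blk s X), vec_nth y0 s') \<le> ereal (d s' l)" if l: "l \<in> H s'" for s' l
        proof -
          have "s' \<noteq> s" using l True by auto
          then have "subvec blk s' (x0 + t *\<^sub>R subvec blk s X) = subvec blk s' x0"
            by (auto simp: subvec_def Finite_Cartesian_Product.vec_eq_iff)
          then show ?thesis using xy0 l by (simp add: Omega_def)
        qed
        then show ?thesis using xy0 by (simp add: Omega_def)
      qed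
      then have "(subvec blk s X, 0 :: real^'k) = 0"
        by (intro zero_on_ray_bounded[OF bdd, of "(x0, y0)"])
      then show ?thesis by (simp add: zero_prod_def)
    next
      case False
      then show ?thesis
        using cone[of s] by (auto simp: Y mem_disj_cone_iff perspective_zero_le_iff)
    qed
    have "vec_nth X i = 0" for i
      using X[of "blk i"] by (auto simp: subvec_def Finite_Cartesian_Product.vec_eq_iff dest: spec[of _ i])
    then show ?thesis by (simp add: eq Y Finite_Cartesian_Product.vec_eq_iff zero_prod_def)
  qed
  moreover have "(0, 0) \<in> Omega_agg blk H h d A b 0"
    by (auto simp: mem_Omega_agg_iff mem_disj_cone_iff perspective_zero_le_iff linear_0[OF linear_subvec]
        subspace_0 subspace_block_space intro!: exI[of _ 0])
  ultimately show ?thesis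
    unfolding zero_prod_def by blast
qed

theorem theorem3:
  fixes blk :: "'d::finite \<Rightarrow> 'k::finite"
    and H :: "'k \<Rightarrow> 'l set"
    and h :: "'k \<Rightarrow> 'l \<Rightarrow> (real^'d) \<times> real \<Rightarrow> ereal"
    and d :: "'k \<Rightarrow> 'l \<Rightarrow> real"
    and A :: "real^'k^'m::finite"
    and b :: "real^'m"
    and r :: nat
  assumes "\<And>s. finite (H s)"
    and "\<And>s l. l \<in> H s \<Longrightarrow> closed_convex_fun (h s l)"
    and "\<And>s l. l \<in> H s \<Longrightarrow> eff_dom (h s l) \<subseteq> block_space blk s \<times> UNIV"
    and "totally_unimodular A"
    and "\<And>i. vec_nth b i \<in> \<int>"
    and "{y. A *v y \<le> b} \<subseteq> {y. \<forall>s. vec_nth y s \<in> {0..1}}"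
    and "bounded (Omega blk H h d A b)"
    and "rel_interior (Omega_per blk H h d A b) \<noteq> {}"
  shows "Omega_agg blk H h d A b r = convex hull (sum_power r (Omega blk H h d A b)) \<and>
         convex hull (sum_power r (Omega blk H h d A b)) = dilate (real r) (Omega_per blk H h d A b)"
proof -
  have per: "convex hull Omega blk H h d A b = Omega_per blk H h d A b"
  proof
    show "convex hull Omega blk H h d A b \<subseteq> Omega_per blk H h d A b"
      by (intro hull_minimal Omega_subset_Omega_per convex_Omega_per assms(2))
    show "Omega_per blk H h d A b \<subseteq> convex hull Omega blk H h d A b"
      by (intro Omega_per_subset_hull assms)
  qed
  \<comment> \<open>The hull of the empty set has empty relative interior. Nonemptiness provides the
    base point for the case \<open>r = 0\<close>.\<close>
  have "Omega blk H h d A b \<noteq> {}"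
    using assms(8) per by (metis convex_hull_empty rel_interior_empty)
  then have "Omega_agg blk H h d A b r = dilate (real r) (Omega_per blk H h d A b)"
    using Omega_agg_0[OF assms(6,7)] by (cases "r = 0") (simp_all add: Omega_agg_eq_dilate dilate_def)
  then show ?thesis
    by (simp add: convex_hull_sum_power per)
qed

end
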